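(* Assume that all series involved converge. Let $r$, $s$, and $l$ be nonnegative integers. If $m$ is even, then $$\sum_{k=1}^\infty \frac{1}{w_{rk+l}\,w_{mk+s}\,w_{m(k+1)+s}} = \frac{1}{u_m w_{m+s}}\sum_{k=1}^\infty \frac{\bigl(w_{r(k+1)+l}- w_{rk+l}\bigr)u_{mk}}{w_{rk+l}\, w_{r(k+1)+l}\, w_{m(k+1)+s}};$$ while if $m$ is odd, then $$\sum_{k=1}^\infty \frac{(-1)^{k-1}}{w_{rk+l}\,w_{mk+s}\,w_{m(k+1)+s}} = \frac{1}{u_m w_{m+s}}\sum_{k=1}^\infty \frac{\bigl(w_{r(k+1)+l}- w_{rk+l}\bigr)u_{mk}}{w_{rk+l}\, w_{r(k+1)+l}\, w_{m(k+1)+s}}.$$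
   Context: The sequence $(w_n)=(w_n(a,b;p))$ is the second-order recurrence sequence defined by $w_n=p\,w_{n-1}+w_{n-2}$ for $n\ge 2$, with initial values $w_0=a$ and $w_1=b$. The sequence $(u_n)$ is defined by $u_0=0$, $u_1=1$, and $u_n=p\,u_{n-1}+u_{n-2}$ for $n\ge 2$.
   Formalization: The formal theorem requires r > 0: for r = 0 the right side is 0, while e.g. a=0, b=1, p=1, l=1, s=0, m=2 makes the left side a positive convergent sum; u_m and all w-terms in denominators are assumed nonzero. *)

theory Defs
  imports Complex_Main
begin

fun w :: "complex \<Rightarrow> complex \<Rightarrow> complex \<Rightarrow> nat \<Rightarrow> complex" where
  "w a b p 0 = a"
| "w a b p (Suc 0) = b"
| "w a b p (Suc (Suc n)) = p * w a b p (Suc n) + w a b p n"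

fun u :: "complex \<Rightarrow> nat \<Rightarrow> complex" where
  "u p 0 = 0"
| "u p (Suc 0) = 1"
| "u p (Suc (Suc n)) = p * u p (Suc n) + u p n"

text \<open>Series indexed by \<open>k = 1, 2, 3, \<dots>\<close>, with ordinary (possibly conditional) convergence
  of the partial sums.\<close>

abbreviation converges_from_1 :: "(nat \<Rightarrow> complex) \<Rightarrow> bool" where
  "converges_from_1 f \<equiv> summable (\<lambda>k. f (Suc k))"

abbreviation series_from_1 :: "(nat \<Rightarrow> complex) \<Rightarrow> complex" where
  "series_from_1 f \<equiv> (\<Sum>k. f (Suc k))"

end

theory Submission
  imports Defs
begin

text \<open>
  Write \<open>V\<^sub>k = w\<^bsub>rk+l\<^esub>\<close> and \<open>W\<^sub>k = w\<^bsub>mk+s\<^esub>\<close>.  The quotients \<open>T\<^sub>k = u\<^bsub>mk\<^esub> / W\<^bsub>k+1\<^esub>\<close> telescope: by a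
  Catalan-type identity, \<open>T\<^sub>k - T\<^bsub>k-1\<^esub>\<close> is \<open>(-1)\<^bsup>m(k-1)\<^esup> u\<^sub>m w\<^bsub>m+s\<^esub> / (W\<^sub>k W\<^bsub>k+1\<^esub>)\<close>.  Hence the
  left-hand series is, up to the factor \<open>u\<^sub>m w\<^bsub>m+s\<^esub>\<close>, the sum of \<open>(T\<^sub>k - T\<^bsub>k-1\<^esub>) / V\<^sub>k\<close>, and summation by
  parts turns it into the right-hand series plus the boundary term \<open>T\<^sub>N / V\<^bsub>N+1\<^esub>\<close>.

  The remaining point is that the boundary term tends to \<open>0\<close>.  Since both series converge, it has
  some limit \<open>L\<close>.  If \<open>L \<noteq> 0\<close>, then convergence forces \<open>V\<^bsub>k+1\<^esub> / V\<^sub>k \<longlonglongrightarrow> 1\<close>.  But \<open>V\<close> satisfies a linear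
  recurrence with characteristic roots \<open>\<alpha>\<^sup>r\<close> and \<open>\<beta>\<^sup>r\<close>, where \<open>\<alpha>\<close> and \<open>\<beta>\<close> are the roots of
  \<open>x\<^sup>2 = p x + 1\<close>, so \<open>1\<close> is one of these roots.  As \<open>\<alpha> \<beta> = -1\<close>, both roots lie on the unit circle.
  If they are distinct, \<open>w\<close> is bounded, and the terms of the left-hand series cannot tend to \<open>0\<close>.
  If they coincide, \<open>w\<close> is either bounded again or grows linearly; in the latter case \<open>T\<close> is
  bounded while \<open>V\<close> tends to infinity, which contradicts \<open>L \<noteq> 0\<close>.
\<close>

section \<open>Algebraic identities\<close>

lemma u_eq_w: "u p n = w 0 1 p n"
  by (induction p n rule: u.induct) auto

lemma w_add: "w a b p (n + Suc m) = u p (Suc m) * w a b p (Suc n) + u p m * w a b p n"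
proof (induction m arbitrary: n)
  case 0
  then show ?case by simp
next
  case (Suc m)
  have "w a b p (n + Suc (Suc m)) = w a b p (Suc n + Suc m)" by simp
  also have "\<dots> = u p (Suc m) * w a b p (Suc (Suc n)) + u p m * w a b p (Suc n)"
    by (rule Suc)
  finally show ?case by (simp add: algebra_simps)
qed

lemma u_add: "u p (n + Suc m) = u p (Suc m) * u p (Suc n) + u p m * u p n"
  using w_add[of 0 1 p n m] by (simp only: u_eq_w)

lemma casoratian_u_w:
  "u p (Suc x) * w a b p (x + j) - u p x * w a b p (Suc (x + j)) = (-1) ^ x * w a b p j"
proof (induction x)
  case 0
  then show ?case by simp
next
  case (Suc x)
  have "u p (Suc (Suc x)) * w a b p (Suc x + j) - u p (Suc x) * w a b p (Suc (Suc x + j))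
      = - (u p (Suc x) * w a b p (x + j) - u p x * w a b p (Suc (x + j)))"
    by (simp add: algebra_simps)
  then show ?case using Suc by simp
qed

text \<open>By the addition formulas, the shift by \<open>m\<close> in both products only contributes a factor \<open>u\<^sub>m\<close>
  to the Casoratian of the two solutions \<open>u\<close> and \<open>w\<close> of the recurrence.\<close>

lemma catalan_u_w:
  "u p (x + m) * w a b p (x + j) - u p x * w a b p (x + j + m) = (-1) ^ x * u p m * w a b p j"
proof (cases m)
  case 0
  then show ?thesis by simp
next
  case (Suc m')
  have "u p (x + m) * w a b p (x + j) - u p x * w a b p (x + j + m)
      = u p m * (u p (Suc x) * w a b p (x + j) - u p x * w a b p (Suc (x + j)))"
    unfolding Suc u_add w_add by (simp add: algebra_simps)
  then show ?thesis by (simp add: casoratian_u_w)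
qed

section \<open>Consequences of the characteristic equation\<close>

lemma characteristic_roots:
  fixes p :: complex
  obtains \<alpha> \<beta> where "\<alpha> + \<beta> = p" "\<alpha> * \<beta> = -1"
proof
  define d where "d = csqrt (p\<^sup>2 + 4)"
  have d2: "d * d = p * p + 4"
    unfolding d_def by (metis power2_csqrt power2_eq_square)
  show "(p + d) / 2 + (p - d) / 2 = p" by (simp add: field_simps)
  show "(p + d) / 2 * ((p - d) / 2) = -1" by (simp add: algebra_simps d2)
qed

context
  fixes a b p \<alpha> \<beta> :: complex
  assumes root_sum: "\<alpha> + \<beta> = p" and root_prod: "\<alpha> * \<beta> = -1"
begin

lemma w_minus_root: "w a b p (Suc n) - \<alpha> * w a b p n = \<beta> ^ n * (b - \<alpha> * a)"
proof (induction n)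
  case 0
  then show ?case by simp
next
  case (Suc n)
  have "w a b p (Suc (Suc n)) - \<alpha> * w a b p (Suc n)
      = (\<alpha> + \<beta>) * w a b p (Suc n) - \<alpha> * \<beta> * w a b p n - \<alpha> * w a b p (Suc n)"
    by (simp add: root_sum root_prod)
  also have "\<dots> = \<beta> * (w a b p (Suc n) - \<alpha> * w a b p n)"
    by (simp add: algebra_simps)
  finally show ?case by (simp add: Suc)
qed

text \<open>The point is that \<open>K\<close> does not depend on \<open>n\<close>: removing the contribution of one root leaves a
  geometric sequence in the other, also when the two roots coincide.\<close>

lemma w_shift_minus_root_power:
  "\<exists>K. \<forall>n. w a b p (n + r) - \<alpha> ^ r * w a b p n = \<beta> ^ n * K"
proof (induction r)
  case 0
  then show ?case by (auto intro: exI[of _ 0])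
next
  case (Suc r)
  then obtain K where K: "\<And>n. w a b p (n + r) - \<alpha> ^ r * w a b p n = \<beta> ^ n * K" by blast
  have "w a b p (n + Suc r) - \<alpha> ^ Suc r * w a b p n
      = \<beta> ^ n * (\<alpha> * K + \<beta> ^ r * (b - \<alpha> * a))" for n
  proof -
    have "w a b p (n + Suc r) - \<alpha> ^ Suc r * w a b p n
        = (w a b p (Suc (n + r)) - \<alpha> * w a b p (n + r))
          + \<alpha> * (w a b p (n + r) - \<alpha> ^ r * w a b p n)"
      by (simp add: algebra_simps)
    also have "\<dots> = \<beta> ^ n * (\<alpha> * K + \<beta> ^ r * (b - \<alpha> * a))"
      unfolding w_minus_root K by (simp add: algebra_simps power_add)
    finally show ?thesis .
  qed
  then show ?case by blast
qed

text \<open>Sampling \<open>w\<close> along an arithmetic progression of difference \<open>r\<close> replaces the characteristic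
  roots by their \<open>r\<close>-th powers.\<close>

lemma w_recurrence_step:
  "w a b p (n + r + r) = (\<alpha> ^ r + \<beta> ^ r) * w a b p (n + r) - \<alpha> ^ r * \<beta> ^ r * w a b p n"
proof -
  obtain K where K: "\<And>n. w a b p (n + r) - \<alpha> ^ r * w a b p n = \<beta> ^ n * K"
    using w_shift_minus_root_power by blast
  have "w a b p (n + r + r) - \<alpha> ^ r * w a b p (n + r)
      = \<beta> ^ r * (w a b p (n + r) - \<alpha> ^ r * w a b p n)"
    unfolding K by (simp add: power_add)
  then show ?thesis by (simp add: algebra_simps)
qed

end

lemma w_double_root:
  assumes "\<alpha> + \<alpha> = p" "\<alpha> * \<alpha> = -1"
  shows "w a b p n = \<alpha> ^ n * (a + of_nat n * ((b - \<alpha> * a) / \<alpha>))"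
proof (induction n)
  case 0
  then show ?case by simp
next
  case (Suc n)
  have "\<alpha> \<noteq> 0" using assms by auto
  then show ?case
    using w_minus_root[OF assms, of a b n] unfolding Suc
    by (simp add: field_simps)
qed

lemma w_bounded_of_distinct_unimodular_roots:
  assumes roots: "\<alpha> + \<beta> = p" "\<alpha> * \<beta> = -1"
    and "\<alpha> \<noteq> \<beta>" "norm \<alpha> = 1" "norm \<beta> = 1"
  shows "\<exists>B. \<forall>n. norm (w a b p n) \<le> B"
proof -
  define B where "B = (norm (b - \<alpha> * a) + norm (b - \<beta> * a)) / norm (\<beta> - \<alpha>)"
  have "norm (w a b p n) \<le> B" for n
  proof -
    have swapped: "\<beta> + \<alpha> = p" "\<beta> * \<alpha> = -1" using roots by (simp_all add: ac_simps)
    have "(\<beta> - \<alpha>) * w a b p n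
        = (w a b p (Suc n) - \<alpha> * w a b p n) - (w a b p (Suc n) - \<beta> * w a b p n)"
      by (simp add: algebra_simps)
    also have "\<dots> = \<beta> ^ n * (b - \<alpha> * a) - \<alpha> ^ n * (b - \<beta> * a)"
      unfolding w_minus_root[OF roots] w_minus_root[OF swapped] ..
    finally have "(\<beta> - \<alpha>) * w a b p n = \<beta> ^ n * (b - \<alpha> * a) - \<alpha> ^ n * (b - \<beta> * a)" .
    then have "norm (\<beta> - \<alpha>) * norm (w a b p n) \<le> norm (b - \<alpha> * a) + norm (b - \<beta> * a)"
      using norm_triangle_ineq4[of "\<beta> ^ n * (b - \<alpha> * a)" "\<alpha> ^ n * (b - \<beta> * a)"] assms
      by (simp add: norm_mult[symmetric]) (simp add: norm_mult norm_power)
    then show ?thesis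
      using assms by (simp add: B_def field_simps)
  qed
  then show ?thesis by blast
qed

section \<open>The boundary term\<close>

lemma bounded_product_not_reciprocal_null:
  fixes f g h e :: "nat \<Rightarrow> complex"
  assumes nz: "\<And>k. f k \<noteq> 0" "\<And>k. g k \<noteq> 0" "\<And>k. h k \<noteq> 0"
    and bd: "\<And>k. norm (f k) \<le> B" "\<And>k. norm (g k) \<le> B" "\<And>k. norm (h k) \<le> B"
    and e: "\<And>k. norm (e k) = 1"
  shows "\<not> (\<lambda>k. e k / (f k * g k * h k)) \<longlonglongrightarrow> 0"
proof
  assume lim: "(\<lambda>k. e k / (f k * g k * h k)) \<longlonglongrightarrow> 0"
  have B: "0 < B" using nz(1) bd(1) by (meson less_le_trans zero_less_norm_iff)
  have "norm (e k / (f k * g k * h k)) \<ge> 1 / (B * B * B)" for k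
  proof -
    have "norm (f k * g k * h k) \<le> B * B * B"
      unfolding norm_mult using bd B by (intro mult_mono) auto
    moreover have "0 < norm (f k * g k * h k)" using nz by simp
    ultimately show ?thesis
      unfolding norm_divide e by (intro divide_left_mono) (use B in auto)
  qed
  moreover have "(\<lambda>k. norm (e k / (f k * g k * h k))) \<longlonglongrightarrow> 0"
    using lim by (rule tendsto_norm_zero)
  ultimately have "1 / (B * B * B) \<le> 0"
    by (meson LIMSEQ_le_const)
  moreover have "0 < 1 / (B * B * B)" using B by simp
  ultimately show False by linarith
qed

lemma affine_over_index_tendsto:
  fixes c q :: complex
  shows "(\<lambda>N. (c + of_nat (r * Suc N + l) * q) / of_nat (Suc N)) \<longlonglongrightarrow> of_nat r * q"
proof -
  have "(\<lambda>N. of_nat r * q + (c + of_nat l * q) * inverse (of_nat (Suc N)))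
      \<longlonglongrightarrow> of_nat r * q + (c + of_nat l * q) * 0"
    by (intro tendsto_intros LIMSEQ_Suc[OF lim_inverse_n])
  moreover have "(c + of_nat (r * Suc N + l) * q) / of_nat (Suc N)
      = of_nat r * q + (c + of_nat l * q) * inverse (of_nat (Suc N))" for N
  proof -
    have "of_nat (Suc N) \<noteq> (0 :: complex)" by (rule of_nat_neq_0)
    then show ?thesis
      unfolding of_nat_add of_nat_mult by (simp add: field_simps del: of_nat_Suc)
  qed
  ultimately show ?thesis by simp
qed

text \<open>Here \<open>|\<alpha>| = 1\<close>, so with \<open>q = (b - \<alpha> a) / \<alpha>\<close> the closed form gives \<open>|w\<^sub>n| = |a + n q|\<close> and
  \<open>|u\<^sub>n| = n\<close>: the denominator of the boundary term grows quadratically in \<open>N\<close>, its numerator only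
  linearly.\<close>

lemma boundary_zero_of_double_root:
  assumes roots: "\<alpha> + \<alpha> = p" "\<alpha> * \<alpha> = -1" and nondegenerate: "b - \<alpha> * a \<noteq> 0"
    and "0 < r" "0 < m"
    and nz: "\<And>N. w a b p (r * Suc N + l) \<noteq> 0" "\<And>N. w a b p (m * Suc N + s) \<noteq> 0"
    and lim: "(\<lambda>N. u p (m * N) / (w a b p (m * Suc N + s) * w a b p (r * Suc N + l))) \<longlonglongrightarrow> L"
      (is "?E \<longlonglongrightarrow> L")
  shows "L = 0"
proof -
  define q where "q = (b - \<alpha> * a) / \<alpha>"
  have \<alpha>0: "\<alpha> \<noteq> 0" using roots by auto
  then have q0: "q \<noteq> 0" using nondegenerate by (simp add: q_def)
  have \<alpha>1: "norm \<alpha> = 1"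
  proof -
    have "norm \<alpha> * norm \<alpha> = 1" using roots(2) by (metis norm_minus_cancel norm_mult norm_one)
    then show ?thesis by (metis abs_norm_cancel abs_square_eq_1 power2_eq_square)
  qed
  have norm_w: "norm (w a b p n) = norm (a + of_nat n * q)" for n
    unfolding w_double_root[OF roots] q_def[symmetric] by (simp add: norm_mult norm_power \<alpha>1)
  have norm_u: "norm (u p n) = of_nat n" for n
    unfolding u_eq_w w_double_root[OF roots]
    by (simp add: norm_mult norm_power norm_divide \<alpha>1)
  let ?A = "\<lambda>r l N. (a + of_nat (r * Suc N + l) * q) / of_nat (Suc N)"
  have eq: "norm (?E N) * norm (?A m s N) * norm (?A r l N)
      = of_nat m * (of_nat N / of_nat (Suc N)) * inverse (of_nat (Suc N))" for N
  proof -
    have ne: "norm (a + of_nat (r * Suc N + l) * q) \<noteq> 0"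
      "norm (a + of_nat (m * Suc N + s) * q) \<noteq> 0"
      using nz[of N] unfolding norm_w[symmetric] by auto
    have "norm (?E N) = of_nat (m * N)
        / (norm (a + of_nat (m * Suc N + s) * q) * norm (a + of_nat (r * Suc N + l) * q))"
      by (simp only: norm_divide norm_mult norm_w norm_u)
    moreover have "x / (y * z) * (y / t) * (z / t) = x / (t * t)"
      if "y \<noteq> 0" "z \<noteq> 0" for x y z t :: real
      using that by (simp add: field_simps)
    ultimately have "norm (?E N) * norm (?A m s N) * norm (?A r l N)
        = of_nat (m * N) / (of_nat (Suc N) * of_nat (Suc N))"
      using ne by (simp only: norm_divide norm_of_nat)
    then show ?thesis by (simp add: divide_inverse del: of_nat_Suc)
  qed
  have "(\<lambda>N. norm (?E N) * norm (?A m s N) * norm (?A r l N))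
      \<longlonglongrightarrow> norm L * norm (of_nat m * q) * norm (of_nat r * q)"
    by (intro tendsto_mult tendsto_norm lim affine_over_index_tendsto)
  moreover have "(\<lambda>N. of_nat m * (of_nat N / of_nat (Suc N)) * inverse (of_nat (Suc N)) :: real)
      \<longlonglongrightarrow> of_nat m * 1 * 0"
    by (intro tendsto_intros LIMSEQ_n_over_Suc_n LIMSEQ_inverse_real_of_nat)
  ultimately have "norm L * norm (of_nat m * q) * norm (of_nat r * q) = 0"
    unfolding eq using LIMSEQ_unique by fastforce
  then show "L = 0" using q0 \<open>0 < r\<close> \<open>0 < m\<close> by simp
qed

text \<open>Dividing the recurrence by \<open>V\<^sub>N\<close> and passing to the limit shows that \<open>1\<close> satisfies the
  characteristic equation.\<close>

lemma root_one_of_quotients_tendsto_one: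
  fixes V :: "nat \<Rightarrow> 'a :: real_normed_field"
  assumes nz: "\<And>N. V N \<noteq> 0"
    and rec: "\<And>N. V (Suc (Suc N)) = (x + y) * V (Suc N) - x * y * V N"
    and lim: "(\<lambda>N. V (Suc N) / V N) \<longlonglongrightarrow> 1"
  shows "x = 1 \<or> y = 1"
proof -
  have "(\<lambda>N. V (Suc (Suc N)) / V (Suc N) * (V (Suc N) / V N)) \<longlonglongrightarrow> 1 * 1"
    by (intro tendsto_mult lim LIMSEQ_Suc[OF lim])
  moreover have "V (Suc (Suc N)) / V (Suc N) * (V (Suc N) / V N)
      = (x + y) * (V (Suc N) / V N) - x * y" for N
    using nz[of N] nz[of "Suc N"] unfolding rec by (simp add: field_simps)
  moreover have "(\<lambda>N. (x + y) * (V (Suc N) / V N) - x * y) \<longlonglongrightarrow> (x + y) * 1 - x * y"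
    by (intro tendsto_intros lim)
  ultimately have "(x + y) - x * y = 1"
    by (metis (no_types, lifting) LIMSEQ_unique ext mult.right_neutral)
  then have "(1 - x) * (1 - y) = 0" by (simp add: algebra_simps)
  then show ?thesis by simp
qed

lemma norm_eq_1_of_power_eq_1:
  fixes z :: "'a :: real_normed_div_algebra"
  assumes "z ^ n = 1" "0 < n"
  shows "norm z = 1"
proof -
  have "norm z ^ n = 1 ^ n" using assms by (metis norm_one norm_power power_one)
  then show ?thesis using assms(2) by (metis norm_ge_zero power_eq_imp_eq_base zero_le_one)
qed

text \<open>The sequence in the last hypothesis and the shifted boundary term \<open>u\<^bsub>m(N+1)\<^esub> / (W\<^bsub>N+1\<^esub> V\<^bsub>N+1\<^esub>)\<close>
  (indices from \<open>0\<close>) differ only in the index of \<open>V\<close>, so if their common limit \<open>L\<close> is not \<open>0\<close>, their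
  quotient shows that \<open>V\<^bsub>N+1\<^esub> / V\<^sub>N \<longlonglongrightarrow> 1\<close>.  This puts both characteristic roots on the unit
  circle, where no growth of \<open>w\<close> is compatible with all three limits.\<close>

lemma boundary_zero:
  assumes "0 < r" "0 < m"
    and nz: "\<And>N. w a b p (r * Suc N + l) \<noteq> 0" "\<And>N. w a b p (m * Suc N + s) \<noteq> 0"
    and terms: "(\<lambda>N. (-1) ^ (m * N) / (w a b p (r * Suc N + l) * w a b p (m * Suc N + s)
          * w a b p (m * Suc (Suc N) + s))) \<longlonglongrightarrow> 0" (is "?x \<longlonglongrightarrow> 0")
    and lim: "(\<lambda>N. u p (m * N) / (w a b p (m * Suc N + s) * w a b p (r * Suc N + l))) \<longlonglongrightarrow> L"
      (is "?E \<longlonglongrightarrow> L")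
    and shifted: "(\<lambda>N. u p (m * Suc N) / (w a b p (m * Suc (Suc N) + s) * w a b p (r * Suc N + l)))
          \<longlonglongrightarrow> L" (is "?F \<longlonglongrightarrow> L")
  shows "L = 0"
proof (rule ccontr)
  assume L: "L \<noteq> 0"
  obtain \<alpha> \<beta> where roots: "\<alpha> + \<beta> = p" "\<alpha> * \<beta> = -1" by (rule characteristic_roots)
  define V where "V N = w a b p (r * Suc N + l)" for N
  have V0: "V N \<noteq> 0" for N using nz(1) by (simp only: V_def not_False_eq_True)
  have sgn1: "norm ((-1 :: complex) ^ (m * N)) = 1" for N by (simp add: norm_power)
  have unbounded: False if bd: "\<And>n. norm (w a b p n) \<le> B" for B
    using bounded_product_not_reciprocal_null[
      where e = "\<lambda>N. (-1) ^ (m * N)" and f = "\<lambda>N. w a b p (r * Suc N + l)"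
        and g = "\<lambda>N. w a b p (m * Suc N + s)" and h = "\<lambda>N. w a b p (m * Suc (Suc N) + s)",
      OF nz(1) nz(2) nz(2) bd bd bd sgn1] terms by blast
  have "(\<lambda>N. V (Suc N) / V N) \<longlonglongrightarrow> 1"
  proof -
    have "(\<lambda>N. ?F N / ?E (Suc N)) \<longlonglongrightarrow> L / L"
      using shifted LIMSEQ_Suc[OF lim] L by (rule tendsto_divide)
    moreover have "eventually (\<lambda>N. ?E (Suc N) \<noteq> 0) sequentially"
      using LIMSEQ_Suc[OF lim] L by (rule tendsto_imp_eventually_ne)
    then have "eventually (\<lambda>N. ?F N / ?E (Suc N) = V (Suc N) / V N) sequentially"
    proof eventually_elim
      case (elim N)
      then have "u p (m * Suc N) \<noteq> 0" by auto
      moreover have "x / (y * z) / (x / (y * t)) = t / z"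
        if "x \<noteq> 0" "y \<noteq> 0" for x y z t :: complex
        using that by (simp add: field_simps)
      ultimately show ?case using nz(2)[of "Suc N"] unfolding V_def by blast
    qed
    ultimately show ?thesis using L by (simp add: tendsto_cong)
  qed
  moreover have "V (Suc (Suc N)) = (\<alpha> ^ r + \<beta> ^ r) * V (Suc N) - \<alpha> ^ r * \<beta> ^ r * V N" for N
    using w_recurrence_step[OF roots, of a b "r * Suc N + l" r]
    by (simp add: V_def algebra_simps)
  ultimately have "\<alpha> ^ r = 1 \<or> \<beta> ^ r = 1"
    using V0 by (intro root_one_of_quotients_tendsto_one)
  then have "norm \<alpha> = 1 \<or> norm \<beta> = 1" using norm_eq_1_of_power_eq_1 \<open>0 < r\<close> by blast
  moreover have "norm \<alpha> * norm \<beta> = 1"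
    using roots(2) by (metis norm_minus_cancel norm_mult norm_one)
  ultimately have norms: "norm \<alpha> = 1" "norm \<beta> = 1" by auto
  show False
  proof (cases "\<alpha> = \<beta>")
    case False
    then show False
      using w_bounded_of_distinct_unimodular_roots[OF roots _ norms] unbounded by blast
  next
    case True
    have droots: "\<alpha> + \<alpha> = p" "\<alpha> * \<alpha> = -1" using roots True by simp_all
    have "b - \<alpha> * a = 0"
      using boundary_zero_of_double_root[OF droots _ \<open>0 < r\<close> \<open>0 < m\<close> nz lim] L by blast
    then have "norm (w a b p n) \<le> norm a" for n
      unfolding w_double_root[OF droots] by (simp add: norm_mult norm_power norms)
    then show False by (rule unbounded)
  qed
qed

section \<open>Summation by parts\<close>

text \<open>The sign \<open>(-1)\<^bsup>mN\<^esup>\<close> is the one that the Catalan-type identity produces; it is \<open>1\<close> for even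
  \<open>m\<close> and \<open>(-1)\<^sup>N\<close> for odd \<open>m\<close>, so both parities are instances.  In the proof, \<open>E\<close> is the boundary
  term; passing from \<open>E\<^sub>N\<close> to \<open>E\<^bsub>N+1\<^esub>\<close> through \<open>F\<^sub>N\<close> advances \<open>T\<close> and \<open>V\<close> separately, and these two
  steps contribute the terms of the left and right series.\<close>

lemma series_identity:
  assumes "0 < r" "0 < m"
    and nz: "\<And>N. w a b p (r * Suc N + l) \<noteq> 0" "\<And>N. w a b p (m * Suc N + s) \<noteq> 0"
    and sum_x: "summable (\<lambda>N. (-1) ^ (m * N) / (w a b p (r * Suc N + l) * w a b p (m * Suc N + s)
          * w a b p (m * Suc (Suc N) + s)))" (is "summable ?x")
    and sum_y: "summable (\<lambda>N. (w a b p (r * Suc (Suc N) + l) - w a b p (r * Suc N + l))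
          * u p (m * Suc N) / (w a b p (r * Suc N + l) * w a b p (r * Suc (Suc N) + l)
          * w a b p (m * Suc (Suc N) + s)))" (is "summable ?y")
  shows "u p m * w a b p (m + s) * suminf ?x = suminf ?y"
proof -
  define C where "C = u p m * w a b p (m + s)"
  define E where "E N = u p (m * N) / (w a b p (m * Suc N + s) * w a b p (r * Suc N + l))" for N
  define F where
    "F N = u p (m * Suc N) / (w a b p (m * Suc (Suc N) + s) * w a b p (r * Suc N + l))" for N
  have F: "F N = E N + C * ?x N" for N
  proof -
    have "m * N + m = m * Suc N" "m * N + (m + s) = m * Suc N + s"
      "m * Suc N + s + m = m * Suc (Suc N) + s" by simp_all
    then have cat: "u p (m * Suc N) * w a b p (m * Suc N + s)
        - u p (m * N) * w a b p (m * Suc (Suc N) + s) = (-1) ^ (m * N) * C"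
      using catalan_u_w[of p "m * N" m a b "m + s"] by (simp only: C_def mult.assoc)
    have "U' / (W' * V) = U / (W * V) + C * (e / (V * W * W'))"
      if "U' * W - U * W' = e * C" "V \<noteq> 0" "W \<noteq> 0" "W' \<noteq> 0" for U U' W W' V e :: complex
      using that by (simp add: field_simps)
    from this[OF cat nz(1) nz(2) nz(2)] show ?thesis by (simp only: E_def F_def)
  qed
  have y: "?y N = F N - E (Suc N)" for N
  proof -
    have "(V' - V) * U / (V * V' * W') = U / (W' * V) - U / (W' * V')"
      if "V \<noteq> 0" "V' \<noteq> 0" "W' \<noteq> 0" for U V V' W' :: complex
      using that by (simp add: field_simps)
    from this[OF nz(1) nz(1) nz(2)] show ?thesis by (simp only: E_def F_def)
  qed
  have E_sum: "(\<Sum>k<N. C * ?x k - ?y k) = E N" for N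
  proof (induction N)
    case 0
    then show ?case by (simp add: E_def)
  next
    case (Suc N)
    then show ?case using F[of N] y[of N] by simp
  qed
  have "(\<lambda>N. C * ?x N - ?y N) sums (C * suminf ?x - suminf ?y)" (is "_ sums ?L")
    by (intro sums_diff sums_mult summable_sums sum_x sum_y)
  then have E_lim: "E \<longlonglongrightarrow> ?L" unfolding sums_def E_sum .
  have x_lim: "?x \<longlonglongrightarrow> 0" using sum_x by (rule summable_LIMSEQ_zero)
  have "(\<lambda>N. E N + C * ?x N) \<longlonglongrightarrow> ?L + C * 0"
    by (intro tendsto_intros E_lim x_lim)
  then have "F \<longlonglongrightarrow> ?L" unfolding F[symmetric] mult_zero_right add_0_right .
  then have "?L = 0"
    using boundary_zero[OF \<open>0 < r\<close> \<open>0 < m\<close> nz x_lim] E_lim unfolding E_def F_def by blast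
  then show ?thesis by (simp add: C_def)
qed

theorem theorem4:
  fixes a b p :: complex and r s l m :: nat
  assumes r_pos: "r > 0"
    and u_nonzero: "u p m \<noteq> 0"
    and w_r_nonzero: "\<And>k. k \<ge> 1 \<Longrightarrow> w a b p (r * k + l) \<noteq> 0"
    and w_m_nonzero: "\<And>k. k \<ge> 1 \<Longrightarrow> w a b p (m * k + s) \<noteq> 0"
    and conv_even: "even m \<Longrightarrow> converges_from_1 (\<lambda>k.
          1 / (w a b p (r * k + l) * w a b p (m * k + s) * w a b p (m * (k + 1) + s)))"
    and conv_odd: "odd m \<Longrightarrow> converges_from_1 (\<lambda>k.
          (-1) ^ (k - 1) / (w a b p (r * k + l) * w a b p (m * k + s) * w a b p (m * (k + 1) + s)))"
    and conv_right: "converges_from_1 (\<lambda>k.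
          (w a b p (r * (k + 1) + l) - w a b p (r * k + l)) * u p (m * k)
          / (w a b p (r * k + l) * w a b p (r * (k + 1) + l) * w a b p (m * (k + 1) + s)))"
  shows "(even m \<longrightarrow>
            series_from_1 (\<lambda>k.
              1 / (w a b p (r * k + l) * w a b p (m * k + s) * w a b p (m * (k + 1) + s)))
            = 1 / (u p m * w a b p (m + s)) * series_from_1 (\<lambda>k.
                (w a b p (r * (k + 1) + l) - w a b p (r * k + l)) * u p (m * k)
                / (w a b p (r * k + l) * w a b p (r * (k + 1) + l) * w a b p (m * (k + 1) + s))))
       \<and> (odd m \<longrightarrow>
            series_from_1 (\<lambda>k.
              (-1) ^ (k - 1) / (w a b p (r * k + l) * w a b p (m * k + s) * w a b p (m * (k + 1) + s)))
            = 1 / (u p m * w a b p (m + s)) * series_from_1 (\<lambda>k.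
                (w a b p (r * (k + 1) + l) - w a b p (r * k + l)) * u p (m * k)
                / (w a b p (r * k + l) * w a b p (r * (k + 1) + l) * w a b p (m * (k + 1) + s))))"
proof -
  let ?sgn = "\<lambda>N. (-1) ^ (m * N) :: complex"
  let ?x = "\<lambda>N. ?sgn N / (w a b p (r * Suc N + l) * w a b p (m * Suc N + s)
    * w a b p (m * Suc (Suc N) + s))"
  have "0 < m" using u_nonzero by (cases m) auto
  have nz: "w a b p (r * Suc N + l) \<noteq> 0" "w a b p (m * Suc N + s) \<noteq> 0" for N
    using w_r_nonzero[of "Suc N"] w_m_nonzero[of "Suc N"] by simp_all
  have nz1: "u p m * w a b p (m + s) \<noteq> 0" using u_nonzero nz(2)[of 0] by simp
  have even_sgn: "?sgn N = 1" if "even m" for N using that by simp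
  have odd_sgn: "?sgn N = (-1) ^ (Suc N - 1)" if "odd m" for N
    using that by (simp add: power_mult)
  have "summable ?x"
  proof (cases "even m")
    case True
    then show ?thesis using conv_even by (simp only: even_sgn Suc_eq_plus1)
  next
    case False
    then show ?thesis using conv_odd by (simp only: odd_sgn Suc_eq_plus1 simp_thms)
  qed
  note scaled = series_identity[OF r_pos \<open>0 < m\<close> nz this conv_right[folded Suc_eq_plus1]]
  have div: "x = 1 / c * y" if "c * x = y" "c \<noteq> 0" for c x y :: complex
    using that by (simp add: field_simps)
  note main = div[OF scaled nz1]
  let ?right = "1 / (u p m * w a b p (m + s)) * series_from_1 (\<lambda>k.
    (w a b p (r * (k + 1) + l) - w a b p (r * k + l)) * u p (m * k)
    / (w a b p (r * k + l) * w a b p (r * (k + 1) + l) * w a b p (m * (k + 1) + s)))"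
  show ?thesis
  proof (intro conjI impI)
    assume "even m"
    then show "series_from_1 (\<lambda>k.
        1 / (w a b p (r * k + l) * w a b p (m * k + s) * w a b p (m * (k + 1) + s))) = ?right"
      using main by (simp only: even_sgn Suc_eq_plus1)
  next
    assume "odd m"
    then show "series_from_1 (\<lambda>k.
        (-1) ^ (k - 1) / (w a b p (r * k + l) * w a b p (m * k + s) * w a b p (m * (k + 1) + s)))
        = ?right"
      using main by (simp only: odd_sgn Suc_eq_plus1 simp_thms)
  qed
qed

end
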